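(* Let $\mathcal{H}$ be a hypermap. Then: (1) $\mathcal{H}$ is uniform of type $(l;m;n)$ if and only if $\mathrm{Wal}(\mathcal{H})$ is bipartite-uniform of bipartite-type $(l,m;2;2n)$ if $l\le m$, or $(m,l;2;2n)$ if $l\ge m$; (2) $\mathcal{H}$ is regular if and only if $\mathrm{Wal}(\mathcal{H})$ is bipartite-regular.
   Context: A hypermap is a tuple $\mathcal{H}=(\Omega;h_0,h_1,h_2)$, where $\Omega$ is a non-empty finite set (of flags) and $h_0,h_1,h_2$ are fixed-point-free involutory permutations of $\Omega$ (acting on the right) generating a group transitive on $\Omega$. For $\{i,j,k\}=\{0,1,2\}$ the $k$-faces are the $\langle h_i,h_j\rangle$-orbits; $0$-, $1$-, $2$-faces are called hypervertices, hyperedges, hyperfaces. The valency of a $k$-face is half its cardinality. $\mathcal{H}$ is uniform of type $(l;m;n)$ if all hypervertices have valency $l$, all hyperedges $m$, all hyperfaces $n$. Let $\Delta=\langle R_0,R_1,R_2\mid R_0^2=R_1^2=R_2^2=1\rangle$. It acts on $\Omega$ by $R_i\mapsto h_i$; the stabiliser $H$ in $\Delta$ of a flag is a hypermap subgroup of $\mathcal{H}$ (unique up to conjugation), and $\mathcal{H}$ is isomorphic to the set of right cosets $\Delta/_r H$ with $R_0,R_1,R_2$ acting by right multiplication. $\mathcal{H}$ is regular if $H\lhd\Delta$. Write $x^g=g^{-1}xg$. $\Delta^{\hat 0}$ is the normal closure of $\{R_1,R_2\}$ in $\Delta$; it has index $2$ and is the free product of the order-two groups generated by $R_1,R_2,R_1^{R_0},R_2^{R_0}$.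 A hypermap is bipartite if its hypermap subgroup is contained in $\Delta^{\hat 0}$ (its flags then split into two $\Delta^{\hat 0}$-orbits and each hypervertex lies in one of them), and bipartite-regular if its hypermap subgroup is a normal subgroup of $\Delta^{\hat 0}$. A bipartite hypermap is bipartite-uniform of bipartite-type $(l_1,l_2;m;n)$, $l_1\le l_2$, if all hypervertices in one $\Delta^{\hat 0}$-orbit have valency $l_1$, all those in the other have valency $l_2$, all hyperedges have valency $m$ and all hyperfaces valency $n$. $\mathrm{Wal}(\mathcal{H})$ is the hypermap with hypermap subgroup $H\varphi_W^{-1}$ (full preimage), where $\varphi_W:\Delta^{\hat 0}\to\Delta$ is the epimorphism with $R_1\varphi_W=R_1$, $R_2\varphi_W=R_2$, $R_1^{R_0}\varphi_W=R_0$, $R_2^{R_0}\varphi_W=R_2$.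
   Formalization: In (1), "if" fails for l≠m, as the bipartite-type forgets which orbit has which valency. Proved: Wal(H) has that type iff H has type (l;m;n) or (m;l;n); and H has type (l;m;n) iff also the hypervertices of Wal(H) in the orbit of the trivial coset have valency l. *)

theory Defs
  imports "HOL-Algebra.Group_Action" "HOL-Algebra.Elementary_Groups"
begin

section \<open>The group \<open>\<Delta>\<close>\<close>

datatype idx = I0 | I1 | I2

lemma UNIV_idx: "(UNIV :: idx set) = {I0, I1, I2}"
  by (auto intro: idx.exhaust)

inductive cancel :: "idx list \<Rightarrow> idx list \<Rightarrow> bool" where
  "cancel (u @ [i, i] @ v) (u @ v)"

definition word_eq :: "idx list \<Rightarrow> idx list \<Rightarrow> bool" where
  "word_eq = equivclp cancel"

lemma equivp_word_eq: "equivp word_eq"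
  unfolding word_eq_def by simp

text \<open>
  The presentation \<open>\<langle>R\<^sub>0, R\<^sub>1, R\<^sub>2 | R\<^sub>0\<^sup>2 = R\<^sub>1\<^sup>2 = R\<^sub>2\<^sup>2 = 1\<rangle>\<close>. Each generator is its own inverse,
  so every element is represented by a positive word, and the relators amount to
  inserting and deleting factors \<open>R\<^sub>i R\<^sub>i\<close>.
\<close>

quotient_type delta = "idx list" / word_eq
  by (rule equivp_word_eq)

lemma word_eq_induct [consumes 1, case_names refl forward backward]:
  assumes "word_eq a b"
    and "P a"
    and "\<And>b c. word_eq a b \<Longrightarrow> cancel b c \<Longrightarrow> P b \<Longrightarrow> P c"
    and "\<And>b c. word_eq a b \<Longrightarrow> cancel c b \<Longrightarrow> P b \<Longrightarrow> P c"
  shows "P b"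
  using assms(1) unfolding word_eq_def
  by (induction rule: equivclp_induct) (use assms(2-) in \<open>auto simp: word_eq_def\<close>)

lemma word_eq_refl: "word_eq a a"
  using equivp_word_eq by (rule equivp_reflp)

lemma word_eq_sym: "word_eq a b \<Longrightarrow> word_eq b a"
  using equivp_word_eq by (rule equivp_symp)

lemma word_eq_trans: "word_eq a b \<Longrightarrow> word_eq b c \<Longrightarrow> word_eq a c"
  using equivp_word_eq by (rule equivp_transp)

lemma cancel_word_eq: "cancel a b \<Longrightarrow> word_eq a b"
  unfolding word_eq_def by (rule r_into_equivclp)

lemma cancel_append: "cancel a b \<Longrightarrow> cancel (p @ a @ q) (p @ b @ q)"
proof (induction rule: cancel.induct)
  case (1 u i v)
  show ?case using cancel.intros[of "p @ u" i "v @ q"] by simp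
qed

lemma word_eq_append1: "word_eq a b \<Longrightarrow> word_eq (p @ a @ q) (p @ b @ q)"
proof (induction rule: word_eq_induct)
  case refl
  show ?case by (rule word_eq_refl)
next
  case (forward b c)
  then show ?case by (meson cancel_append cancel_word_eq word_eq_trans)
next
  case (backward b c)
  then show ?case by (meson cancel_append cancel_word_eq word_eq_sym word_eq_trans)
qed

lemma word_eq_append: "word_eq a b \<Longrightarrow> word_eq c d \<Longrightarrow> word_eq (a @ c) (b @ d)"
  using word_eq_append1[of a b "[]" c] word_eq_append1[of c d b "[]"]
  by (auto intro: word_eq_trans)

lemma word_eq_rev: "word_eq (w @ rev w) []"
proof (induction w)
  case Nil
  show ?case by (simp add: word_eq_refl)
next
  case (Cons i w)
  have "word_eq ([i] @ (w @ rev w) @ [i]) ([i] @ [] @ [i])"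
    by (rule word_eq_append1[OF Cons])
  moreover have "word_eq [i, i] []"
    using cancel.intros[of "[]" i "[]"] by (auto intro: cancel_word_eq)
  ultimately show ?case by (auto intro: word_eq_trans)
qed

lift_definition delta_mult :: "delta \<Rightarrow> delta \<Rightarrow> delta" is "(@)"
  by (rule word_eq_append)

lift_definition delta_one :: delta is "[]" .

lift_definition R :: "idx \<Rightarrow> delta" is "\<lambda>i. [i]" .

definition Delta :: "delta monoid" where
  "Delta = \<lparr>carrier = UNIV, mult = delta_mult, one = delta_one\<rparr>"

lemma group_Delta: "group Delta"
proof (rule groupI)
  fix x y z
  show "(x \<otimes>\<^bsub>Delta\<^esub> y) \<otimes>\<^bsub>Delta\<^esub> z = x \<otimes>\<^bsub>Delta\<^esub> (y \<otimes>\<^bsub>Delta\<^esub> z)"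
    unfolding Delta_def by simp (transfer, simp add: word_eq_refl)
  show "\<one>\<^bsub>Delta\<^esub> \<otimes>\<^bsub>Delta\<^esub> x = x"
    unfolding Delta_def by simp (transfer, simp add: word_eq_refl)
  have "\<exists>y. delta_mult y x = delta_one"
  proof transfer
    fix w :: "idx list"
    show "\<exists>v. word_eq (v @ w) []"
      using word_eq_rev[of "rev w"] by auto
  qed
  then show "\<exists>y\<in>carrier Delta. y \<otimes>\<^bsub>Delta\<^esub> x = \<one>\<^bsub>Delta\<^esub>"
    by (simp add: Delta_def)
qed (simp_all add: Delta_def)

definition normal_closure :: "('a, 'b) monoid_scheme \<Rightarrow> 'a set \<Rightarrow> 'a set" where
  "normal_closure G S = \<Inter> {N. N \<lhd> G \<and> S \<subseteq> N}"

definition Delta0 :: "delta monoid" where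
  "Delta0 = Delta\<lparr>carrier := normal_closure Delta {R I1, R I2}\<rparr>"

definition conj_by :: "delta \<Rightarrow> delta \<Rightarrow> delta" where
  "conj_by x g = inv\<^bsub>Delta\<^esub> g \<otimes>\<^bsub>Delta\<^esub> x \<otimes>\<^bsub>Delta\<^esub> g"

definition is_walsh_epi :: "(delta \<Rightarrow> delta) \<Rightarrow> bool" where
  "is_walsh_epi f \<longleftrightarrow> f \<in> epi Delta0 Delta \<and>
     f (R I1) = R I1 \<and> f (R I2) = R I2 \<and>
     f (conj_by (R I1) (R I0)) = R I0 \<and> f (conj_by (R I2) (R I0)) = R I2"

text \<open>
  Since \<open>hom\<close> only constrains functions on the carrier, the epimorphism is determined on
  \<open>carrier Delta0\<close> only; its values elsewhere are never used. Existence is lemma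
  \<open>is_walsh_epi_phi_W\<close> below.
\<close>

definition phi_W :: "delta \<Rightarrow> delta" where
  "phi_W = (SOME f. is_walsh_epi f)"


section \<open>Hypermaps\<close>

record 'a hypermap =
  flags :: "'a set"
  invol :: "idx \<Rightarrow> 'a \<Rightarrow> 'a"

text \<open>
  The permutations belong to the library group \<open>BijGroup\<close>, whose elements are extensional
  functions. Its product composes from right to left, but the orbits of a subgroup do not
  depend on that.
\<close>

definition hypermap :: "'a hypermap \<Rightarrow> bool" where
  "hypermap K \<longleftrightarrow>
     finite (flags K) \<and> flags K \<noteq> {} \<and>
     (\<forall>i. invol K i \<in> Bij (flags K) \<and>
        (\<forall>x\<in>flags K. invol K i (invol K i x) = x \<and> invol K i x \<noteq> x)) \<and>
     (\<forall>x\<in>flags K. \<forall>y\<in>flags K.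
        \<exists>g\<in>carrier (subgroup_generated (BijGroup (flags K)) (range (invol K))). g x = y)"

definition faces :: "idx \<Rightarrow> 'a hypermap \<Rightarrow> 'a set set" where
  "faces k K =
     orbits (subgroup_generated (BijGroup (flags K)) (invol K ` (- {k}))) (flags K) (\<lambda>g. g)"

definition valency :: "'a set \<Rightarrow> nat" where
  "valency F = card F div 2"

definition uniform :: "'a hypermap \<Rightarrow> nat \<Rightarrow> nat \<Rightarrow> nat \<Rightarrow> bool" where
  "uniform K l m n \<longleftrightarrow> hypermap K \<and>
     (\<forall>F\<in>faces I0 K. valency F = l) \<and>
     (\<forall>F\<in>faces I1 K. valency F = m) \<and>
     (\<forall>F\<in>faces I2 K. valency F = n)"

text \<open>
  \<open>act K g x\<close> is the flag obtained from \<open>x\<close> by the right action of \<open>g\<close>: the letters of a word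
  act from left to right. By lemma \<open>act_abs_delta\<close> the chosen representative is irrelevant.
\<close>

definition act :: "'a hypermap \<Rightarrow> delta \<Rightarrow> 'a \<Rightarrow> 'a" where
  "act K g = fold (invol K) (rep_delta g)"

definition hypermap_subgroup :: "'a hypermap \<Rightarrow> 'a \<Rightarrow> delta set" where
  "hypermap_subgroup K x = stabilizer Delta (act K) x"

text \<open>
  The subgroups belonging to different flags are conjugate in \<open>\<Delta>\<close>, so in each of the three
  definitions below quantifying over all flags or over some flag makes no difference.
\<close>

definition regular :: "'a hypermap \<Rightarrow> bool" where
  "regular K \<longleftrightarrow> hypermap K \<and> (\<forall>x\<in>flags K. hypermap_subgroup K x \<lhd> Delta)"

definition bipartite :: "'a hypermap \<Rightarrow> bool" where
  "bipartite K \<longleftrightarrow> hypermap K \<and> (\<forall>x\<in>flags K. hypermap_subgroup K x \<subseteq> carrier Delta0)"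

definition bipartite_regular :: "'a hypermap \<Rightarrow> bool" where
  "bipartite_regular K \<longleftrightarrow> hypermap K \<and> (\<forall>x\<in>flags K. hypermap_subgroup K x \<lhd> Delta0)"

definition bipartite_uniform :: "'a hypermap \<Rightarrow> nat \<Rightarrow> nat \<Rightarrow> nat \<Rightarrow> nat \<Rightarrow> bool" where
  "bipartite_uniform K l\<^sub>1 l\<^sub>2 m n \<longleftrightarrow> bipartite K \<and> l\<^sub>1 \<le> l\<^sub>2 \<and>
     (\<exists>A B. orbits Delta0 (flags K) (act K) = {A, B} \<and> A \<noteq> B \<and>
        (\<forall>F\<in>faces I0 K. F \<subseteq> A \<longrightarrow> valency F = l\<^sub>1) \<and>
        (\<forall>F\<in>faces I0 K. F \<subseteq> B \<longrightarrow> valency F = l\<^sub>2)) \<and>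
     (\<forall>F\<in>faces I1 K. valency F = m) \<and>
     (\<forall>F\<in>faces I2 K. valency F = n)"

definition coset_hypermap :: "delta set \<Rightarrow> delta set hypermap" where
  "coset_hypermap H =
     \<lparr>flags = rcosets\<^bsub>Delta\<^esub> H,
      invol = (\<lambda>i. \<lambda>C \<in> rcosets\<^bsub>Delta\<^esub> H. C #>\<^bsub>Delta\<^esub> R i)\<rparr>"

definition Wal_subgroup :: "'a hypermap \<Rightarrow> 'a \<Rightarrow> delta set" where
  "Wal_subgroup K x = {g \<in> carrier Delta0. phi_W g \<in> hypermap_subgroup K x}"

text \<open>Changing the flag \<open>x\<close> changes \<open>Wal K x\<close> by an isomorphism only.\<close>

definition Wal :: "'a hypermap \<Rightarrow> 'a \<Rightarrow> delta set hypermap" where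
  "Wal K x = coset_hypermap (Wal_subgroup K x)"

text \<open>
  The bipartite-type does not record which of the two \<open>Delta0\<close>-orbits carries which valency.
  In \<open>Wal K x\<close> the orbits are distinguishable: \<open>Wal_subgroup K x\<close>, the trivial coset, is a
  flag, and the hypervertices in its orbit are those coming from the hypervertices of \<open>K\<close>
  (the others come from its hyperedges). The following says that they have valency \<open>l\<close>.
\<close>

definition Wal_base_valency :: "'a hypermap \<Rightarrow> 'a \<Rightarrow> nat \<Rightarrow> bool" where
  "Wal_base_valency K x l \<longleftrightarrow>
     (\<forall>F\<in>faces I0 (Wal K x).
        F \<subseteq> orbit Delta0 (act (Wal K x)) (Wal_subgroup K x) \<longrightarrow> valency F = l)"


section \<open>Well-definedness\<close>

lemma hypermap_involD:
  assumes "hypermap K" "x \<in> flags K"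
  shows "invol K i x \<in> flags K" "invol K i (invol K i x) = x" "invol K i x \<noteq> x"
  using assms Bij_imp_funcset[of "invol K i" "flags K"] by (auto simp: hypermap_def)

lemma fold_invol_closed:
  assumes "hypermap K" "x \<in> flags K"
  shows "fold (invol K) w x \<in> flags K"
  using assms by (induction w arbitrary: x) (auto simp: hypermap_involD)

lemma fold_invol_cancel:
  assumes "hypermap K" "x \<in> flags K" "cancel v w"
  shows "fold (invol K) v x = fold (invol K) w x"
  using assms(3)
  by cases (simp add: hypermap_involD[OF assms(1)] fold_invol_closed[OF assms(1,2)])

lemma fold_invol_cong:
  assumes "hypermap K" "x \<in> flags K" "word_eq v w"
  shows "fold (invol K) v x = fold (invol K) w x"
  using assms(3) by (induction rule: word_eq_induct) (auto dest: fold_invol_cancel[OF assms(1,2)])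

lemma act_abs_delta:
  assumes "hypermap K" "x \<in> flags K"
  shows "act K (abs_delta w) x = fold (invol K) w x"
proof -
  have "word_eq (rep_delta (abs_delta w)) w"
    using Quotient_delta word_eq_refl by (rule Quotient_rep_abs)
  then show ?thesis unfolding act_def by (rule fold_invol_cong[OF assms])
qed

lemma act_R:
  assumes "hypermap K" "x \<in> flags K"
  shows "act K (R i) x = invol K i x"
  using act_abs_delta[OF assms, of "[i]"] by (simp add: R.abs_eq)

lemma act_mult:
  assumes "hypermap K" "x \<in> flags K"
  shows "act K (g \<otimes>\<^bsub>Delta\<^esub> h) x = act K h (act K g x)"
proof -
  obtain v w where "g = abs_delta v" "h = abs_delta w"
    by (metis Quotient_abs_rep[OF Quotient_delta])
  then show ?thesis
    using assms by (simp add: Delta_def delta_mult.abs_eq act_abs_delta fold_invol_closed)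
qed


lemma Delta_simps [simp]:
  "carrier Delta = UNIV" "mult Delta = delta_mult" "one Delta = delta_one"
  by (simp_all add: Delta_def)

lemma delta_cases: obtains w where "g = abs_delta w"
  by (metis Quotient_abs_rep[OF Quotient_delta])

lemma subgroup_normal_closure:
  assumes "group G" "S \<subseteq> carrier G"
  shows "subgroup (normal_closure G S) G"
proof -
  interpret group G by fact
  have "carrier G \<in> {N. N \<lhd> G \<and> S \<subseteq> N}"
    using assms(2) by (auto intro!: normal_invI subgroup_self)
  then show ?thesis
    unfolding normal_closure_def
    by (intro subgroups_Inter) (auto dest: normal_imp_subgroup)
qed

lemma normal_closure_conj:
  assumes "group G" "s \<in> S" "g \<in> carrier G"
  shows "inv\<^bsub>G\<^esub> g \<otimes>\<^bsub>G\<^esub> s \<otimes>\<^bsub>G\<^esub> g \<in> normal_closure G S"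
  unfolding normal_closure_def
  using assms by (auto intro: normal.inv_op_closed1)

fun word_parity :: "idx list \<Rightarrow> bool" where
  "word_parity [] = False"
| "word_parity (i # w) = ((i = I0) \<noteq> word_parity w)"

lemma word_parity_append: "word_parity (u @ v) = (word_parity u \<noteq> word_parity v)"
  by (induction u) auto

lemma word_parity_cancel: "cancel u v \<Longrightarrow> word_parity u = word_parity v"
  by (induction rule: cancel.induct) (auto simp: word_parity_append)

lift_definition parity :: "delta \<Rightarrow> bool" is word_parity
  subgoal for u v by (induction rule: word_eq_induct) (auto dest: word_parity_cancel)
  done

fun walsh_word :: "bool \<Rightarrow> idx list \<Rightarrow> idx list" where
  "walsh_word s [] = []"
| "walsh_word s (I0 # w) = walsh_word (\<not> s) w"
| "walsh_word s (I1 # w) = (if s then I0 else I1) # walsh_word s w"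
| "walsh_word s (I2 # w) = I2 # walsh_word s w"

lemma walsh_word_append:
  "walsh_word s (u @ v) = walsh_word s u @ walsh_word (s \<noteq> word_parity u) v"
proof (induction u arbitrary: s)
  case (Cons i u)
  then show ?case by (cases i) auto
qed simp

lemma walsh_word_cancel: "cancel u v \<Longrightarrow> word_eq (walsh_word s u) (walsh_word s v)"
proof (induction rule: cancel.induct)
  case (1 u i v)
  let ?s = "s \<noteq> word_parity u"
  have "word_eq [j, j] []" for j
    using cancel.intros[of "[]" j "[]"] by (auto intro: cancel_word_eq)
  then have "word_eq (walsh_word ?s [i, i]) []"
    by (cases i) (auto simp: word_eq_refl)
  then have "word_eq (walsh_word s u @ walsh_word ?s [i, i] @ walsh_word ?s v)
     (walsh_word s u @ [] @ walsh_word ?s v)"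
    by (rule word_eq_append1)
  moreover have "walsh_word s (u @ [i, i] @ v) =
      walsh_word s u @ walsh_word ?s [i, i] @ walsh_word ?s v"
    by (simp only: walsh_word_append) (simp add: word_parity_append)
  ultimately show ?case by (simp add: walsh_word_append)
qed

lift_definition walsh :: "delta \<Rightarrow> delta" is "walsh_word False"
  subgoal for u v
    by (induction rule: word_eq_induct)
      (blast intro: word_eq_refl word_eq_trans word_eq_sym walsh_word_cancel)+
  done

lemma parity_mult: "parity (delta_mult g h) = (parity g \<noteq> parity h)"
  by transfer (rule word_parity_append)

lemma parity_one: "\<not> parity delta_one"
  by transfer simp

lemma walsh_mult: "\<not> parity g \<Longrightarrow> walsh (delta_mult g h) = delta_mult (walsh g) (walsh h)"
  by transfer (simp add: walsh_word_append word_eq_refl)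

lemma inv_R: "inv\<^bsub>Delta\<^esub> (R i) = R i"
proof -
  interpret group Delta by (rule group_Delta)
  have "delta_mult (R i) (R i) = delta_one"
    by transfer (use cancel.intros[of "[]" _ "[]"] in \<open>auto intro: cancel_word_eq\<close>)
  then show ?thesis using inv_unique'[of "R i" "R i"] by simp
qed

lemma parity_inv: "parity (inv\<^bsub>Delta\<^esub> g) = parity g"
proof -
  interpret group Delta by (rule group_Delta)
  have "delta_mult (inv\<^bsub>Delta\<^esub> g) g = delta_one" using l_inv[of g] by simp
  then show ?thesis using parity_mult parity_one by metis
qed

lemma subgroup_Delta0: "subgroup (carrier Delta0) Delta"
  by (simp add: Delta0_def subgroup_normal_closure group_Delta)

lemma parity_Delta0:
  assumes "g \<in> carrier Delta0"
  shows "\<not> parity g"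
proof -
  interpret group Delta by (rule group_Delta)
  have "subgroup {g. \<not> parity g} Delta"
    by (rule subgroupI) (use parity_one in \<open>auto simp: parity_mult parity_inv\<close>)
  then have "{g. \<not> parity g} \<lhd> Delta"
    by (rule normal_invI) (auto simp: parity_mult parity_inv)
  moreover have "\<not> parity (R I1)" "\<not> parity (R I2)"
    by (transfer, simp)+
  ultimately show ?thesis
    using assms by (auto simp: Delta0_def normal_closure_def)
qed

lemma conj_by_Delta0: "i \<noteq> I0 \<Longrightarrow> conj_by (R i) g \<in> carrier Delta0"
  unfolding conj_by_def Delta0_def
  by (cases i) (auto simp del: Delta_simps intro!: normal_closure_conj group_Delta simp: Delta_simps(1))

lemma R_Delta0: "i \<noteq> I0 \<Longrightarrow> R i \<in> carrier Delta0"
  unfolding Delta0_def normal_closure_def by (cases i) auto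

lemma walsh_values:
  "walsh (R I1) = R I1" "walsh (R I2) = R I2"
  "walsh (conj_by (R I1) (R I0)) = R I0" "walsh (conj_by (R I2) (R I0)) = R I2"
  unfolding conj_by_def inv_R Delta_simps by (transfer, simp add: word_eq_refl)+

lemma is_walsh_epi_walsh: "is_walsh_epi walsh"
proof -
  interpret group Delta by (rule group_Delta)
  have "walsh \<in> hom Delta0 Delta"
    using parity_Delta0 by (auto simp: hom_def Delta0_def walsh_mult)
  moreover have "\<exists>g\<in>carrier Delta0. walsh g = abs_delta w" for w
  proof (induction w)
    case Nil
    have "walsh delta_one = abs_delta []"
      by (simp add: delta_one.abs_eq walsh.abs_eq)
    then show ?case using subgroup.one_closed[OF subgroup_Delta0] by auto
  next
    case (Cons i w)
    then obtain g where g: "g \<in> carrier Delta0" "walsh g = abs_delta w" by blast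
    obtain r where r: "r \<in> carrier Delta0" "walsh r = R i"
      using walsh_values conj_by_Delta0 R_Delta0 by (cases i) blast+
    have "walsh (delta_mult r g) = abs_delta (i # w)"
      using g r parity_Delta0 by (simp add: walsh_mult R.abs_eq delta_mult.abs_eq)
    moreover have "delta_mult r g \<in> carrier Delta0"
      using subgroup.m_closed[OF subgroup_Delta0 r(1) g(1)] by simp
    ultimately show ?case by blast
  qed
  then have "walsh ` carrier Delta0 = UNIV"
    by (metis UNIV_eq_I delta_cases image_eqI)
  ultimately show ?thesis
    by (simp add: is_walsh_epi_def epi_def walsh_values)
qed

lemma is_walsh_epi_phi_W: "is_walsh_epi phi_W"
  unfolding phi_W_def by (rule someI[of is_walsh_epi, OF is_walsh_epi_walsh])

end

theory Submission
  imports Defs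
begin

text \<open>
  The Walsh hypermap has a concrete model. Take two copies of the flags of \<open>K\<close>, indexed by a
  Boolean sheet. Let \<open>R\<^sub>0\<close> exchange the sheets, let \<open>R\<^sub>2\<close> act on both sheets as it does on \<open>K\<close>,
  and let \<open>R\<^sub>1\<close> act as \<open>R\<^sub>1\<close> on the lower sheet (\<open>False\<close>) and as \<open>R\<^sub>0\<close> on the upper one (\<open>True\<close>).
  An element \<open>g\<close> of \<open>\<Delta>\<close> sends the lower sheet to itself iff it has an even number of letters
  \<open>R\<^sub>0\<close>, that is, iff it lies in \<open>\<Delta>\<^sup>0\<close>, the domain of the Walsh epimorphism; it then acts on the
  lower sheet as its image under that epimorphism acts on \<open>K\<close>. So the stabiliser of the lower
  copy of \<open>x\<close> is exactly the subgroup that defines \<open>Wal K x\<close> (lemma \<open>Wal_subgroup_eq\<close>), and as a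
  transitive action is isomorphic to the action on the cosets of a stabiliser, the doubled flag
  set is a model of \<open>Wal K x\<close> (lemmas \<open>hypermap_iso_coset\<close> and \<open>Wal_iso_double\<close>).

  In the model both parts of the theorem can be read off. The group generated by \<open>R\<^sub>1, R\<^sub>2\<close> acts
  on the lower sheet as \<open>R\<^sub>1, R\<^sub>2\<close> do on \<open>K\<close> and on the upper sheet as \<open>R\<^sub>0, R\<^sub>2\<close> do, so the
  hypervertices are the hypervertices of \<open>K\<close> on one sheet and the hyperedges of \<open>K\<close> on the other;
  hyperedges are the two copies of a pair \<open>{y, y R\<^sub>2}\<close>; and a hyperface is a hyperface of \<open>K\<close>
  taken on both sheets, with twice the valency. The two sheets are the two \<open>\<Delta>\<^sup>0\<close>-orbits.
  For regularity, the stabiliser of a flag is normal iff it fixes every other flag of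
  the orbit (lemma \<open>hypermap_subgroup_normal_iff\<close>); on either sheet the elements of \<open>\<Delta>\<^sup>0\<close> induce
  the same permutations that \<open>\<Delta>\<close> induces on \<open>K\<close>, so the two conditions agree.
\<close>


section \<open>Orbits of a set of involutions\<close>

text \<open>
  A group generated by involutions has the same orbits as the monoid they generate. The
  inductive description makes every statement about faces and about transitivity an induction.
\<close>

inductive_set reach :: "(idx \<Rightarrow> 'a \<Rightarrow> 'a) \<Rightarrow> idx set \<Rightarrow> 'a \<Rightarrow> 'a set" for h I x where
  base: "x \<in> reach h I x"
| step: "y \<in> reach h I x \<Longrightarrow> i \<in> I \<Longrightarrow> h i y \<in> reach h I x"

lemma reach_trans:
  assumes "z \<in> reach h I y" "y \<in> reach h I x"
  shows "z \<in> reach h I x"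
  using assms by (induction rule: reach.induct) (auto intro: reach.step)

lemma reach_closed:
  assumes "y \<in> reach h I x" "x \<in> S" "\<And>i z. i \<in> I \<Longrightarrow> z \<in> S \<Longrightarrow> h i z \<in> S"
  shows "y \<in> S"
  using assms by (induction rule: reach.induct) auto

lemma reach_fold:
  assumes "y \<in> reach h I x"
  obtains w where "y = fold h w x"
proof -
  have "\<exists>w. y = fold h w x"
    using assms
  proof (induction rule: reach.induct)
    case base
    show ?case by (rule exI[of _ "[]"]) simp
  next
    case (step y i)
    then obtain w where "y = fold h w x" by blast
    then show ?case by (intro exI[of _ "w @ [i]"]) simp
  qed
  then show ?thesis using that by blast
qed

lemma orbit_generated_involutions:
  assumes h: "\<And>i. i \<in> I \<Longrightarrow> h i \<in> Bij S"
    and inv: "\<And>i y. i \<in> I \<Longrightarrow> y \<in> S \<Longrightarrow> h i (h i y) = y"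
    and x: "x \<in> S"
  shows "{g x | g. g \<in> carrier (subgroup_generated (BijGroup S) (h ` I))} = reach h I x"
proof -
  let ?G = "generate (BijGroup S) (h ` I)"
  have "carrier (BijGroup S) \<inter> h ` I = h ` I"
    using h by (auto simp: BijGroup_def)
  then have G: "carrier (subgroup_generated (BijGroup S) (h ` I)) = ?G"
    by (simp add: carrier_subgroup_generated)
  interpret group "BijGroup S" by (rule group_BijGroup)
  have car: "h ` I \<subseteq> carrier (BijGroup S)"
    using h by (auto simp: BijGroup_def)
  have Bij: "g \<in> Bij S" if "g \<in> ?G" for g
    using generate_in_carrier[OF car that] by (simp add: BijGroup_def)
  have clos: "h i y \<in> S" if "i \<in> I" "y \<in> S" for i y
    using Bij_imp_funcset[OF h[OF that(1)]] that(2) by auto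
  have sub: "g y \<in> reach h I y" if "g \<in> ?G" "y \<in> S" for g y
    using that
  proof (induction arbitrary: y rule: generate.induct)
    case one
    then show ?case by (simp add: BijGroup_def reach.base)
  next
    case (incl k)
    then show ?case by (auto intro: reach.intros)
  next
    case (inv k)
    then obtain i where i: "i \<in> I" "k = h i" by blast
    have "inj_on (h i) S" using h[OF i(1)] by (simp add: Bij_def bij_betw_def)
    then have "inv_into S (h i) y = h i y"
      using i inv.prems clos assms(2) by (intro inv_into_f_eq) auto
    then show ?case
      using i inv.prems h by (auto simp: inv_BijGroup intro: reach.intros)
  next
    case (eng g1 g2)
    have "g2 y \<in> S" using Bij_imp_funcset[OF Bij[OF eng(2)]] eng.prems by auto
    then have "g1 (g2 y) \<in> reach h I y"
      using eng by (blast intro: reach_trans)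
    then show ?case
      using Bij[OF eng(1)] Bij[OF eng(2)] eng.prems by (simp add: BijGroup_def compose_eq)
  qed
  have sup: "\<exists>g\<in>?G. y = g x" if "y \<in> reach h I x" for y
    using that
  proof (induction rule: reach.induct)
    case base
    have "\<one>\<^bsub>BijGroup S\<^esub> x = x" using x by (simp add: BijGroup_def)
    then show ?case using generate.one[of "BijGroup S" "h ` I"] by metis
  next
    case (step y i)
    then obtain g where g: "g \<in> ?G" "y = g x" by blast
    have "h i \<otimes>\<^bsub>BijGroup S\<^esub> g \<in> ?G"
      by (rule generate.eng[OF generate.incl[OF imageI[OF step(2)]] g(1)])
    moreover have "(h i \<otimes>\<^bsub>BijGroup S\<^esub> g) x = h i y"
      using h[OF step(2)] Bij[OF g(1)] x g(2) by (simp add: BijGroup_def compose_eq)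
    ultimately show ?case by metis
  qed
  show ?thesis
    unfolding G
  proof (intro equalityI subsetI)
    show "y \<in> reach h I x" if "y \<in> {g x | g. g \<in> ?G}" for y
      using that sub x by auto
    show "y \<in> {g x | g. g \<in> ?G}" if "y \<in> reach h I x" for y
      using sup[OF that] by (elim bexE) (rule CollectI, rule exI, rule conjI)
  qed
qed


section \<open>Hypermaps through orbits of words\<close>

lemma hypermapI:
  assumes "finite (flags K)" "flags K \<noteq> {}"
    and ext: "\<And>i. invol K i \<in> extensional (flags K)"
    and clos: "\<And>i y. y \<in> flags K \<Longrightarrow> invol K i y \<in> flags K"
    and inv: "\<And>i y. y \<in> flags K \<Longrightarrow> invol K i (invol K i y) = y"
    and "\<And>i y. y \<in> flags K \<Longrightarrow> invol K i y \<noteq> y"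
    and trans: "\<And>y z. y \<in> flags K \<Longrightarrow> z \<in> flags K \<Longrightarrow> z \<in> reach (invol K) UNIV y"
  shows "hypermap K"
proof -
  have Bij: "invol K i \<in> Bij (flags K)" for i
  proof -
    have "bij_betw (invol K i) (flags K) (flags K)"
      by (rule bij_betw_byWitness[where f' = "invol K i"]) (auto simp: clos inv)
    then show ?thesis using ext by (simp add: Bij_def)
  qed
  have "\<exists>g\<in>carrier (subgroup_generated (BijGroup (flags K)) (range (invol K))). g y = z"
    if "y \<in> flags K" "z \<in> flags K" for y z
  proof -
    have "{g y | g. g \<in> carrier (subgroup_generated (BijGroup (flags K)) (range (invol K)))} =
        reach (invol K) UNIV y"
      by (rule orbit_generated_involutions) (use Bij inv that in auto)
    then have "z \<in> {g y | g. g \<in> carrier (subgroup_generated (BijGroup (flags K))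
        (range (invol K)))}"
      using trans[OF that] by simp
    then show ?thesis by auto
  qed
  then show ?thesis using assms Bij by (simp add: hypermap_def)
qed

lemma hypermap_reach:
  assumes "hypermap K" "y \<in> flags K"
  shows "{g y | g. g \<in> carrier (subgroup_generated (BijGroup (flags K)) (invol K ` I))} =
    reach (invol K) I y"
  using assms by (intro orbit_generated_involutions) (auto simp: hypermap_def)

lemma faces_eq_reach:
  assumes "hypermap K"
  shows "faces k K = reach (invol K) (- {k}) ` flags K"
  unfolding faces_def orbits_def orbit_def
  using hypermap_reach[OF assms, of _ "- {k}"] by auto

lemma reach_subset_flags:
  assumes "hypermap K" "y \<in> flags K"
  shows "reach (invol K) I y \<subseteq> flags K"
  using assms by (auto intro: reach_closed hypermap_involD)

lemma face_subset:
  assumes "hypermap K" "F \<in> faces k K"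
  shows "F \<subseteq> flags K" "F \<noteq> {}"
proof -
  obtain y where y: "y \<in> flags K" "F = reach (invol K) (- {k}) y"
    using assms by (auto simp: faces_eq_reach)
  show "F \<subseteq> flags K" using reach_subset_flags[OF assms(1) y(1)] y(2) by simp
  have "y \<in> F" unfolding y(2) by (rule reach.base)
  then show "F \<noteq> {}" by blast
qed

lemma faces_nonempty:
  assumes "hypermap K"
  shows "faces k K \<noteq> {}"
  using assms by (simp add: faces_eq_reach) (simp add: hypermap_def)

lemma reach_UNIV:
  assumes "hypermap K" "y \<in> flags K"
  shows "reach (invol K) UNIV y = flags K"
proof
  show "reach (invol K) UNIV y \<subseteq> flags K" by (rule reach_subset_flags[OF assms])
  show "flags K \<subseteq> reach (invol K) UNIV y"
  proof
    fix z assume "z \<in> flags K"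
    then obtain g where "g y = z"
        "g \<in> carrier (subgroup_generated (BijGroup (flags K)) (range (invol K)))"
      using assms unfolding hypermap_def by blast
    then show "z \<in> reach (invol K) UNIV y"
      using hypermap_reach[OF assms, of UNIV] by blast
  qed
qed

lemma act_closed:
  assumes "hypermap K" "y \<in> flags K"
  shows "act K g y \<in> flags K"
  unfolding act_def by (rule fold_invol_closed[OF assms])

lemma act_one:
  assumes "hypermap K" "y \<in> flags K"
  shows "act K delta_one y = y"
  using act_abs_delta[OF assms, of "[]"] by (simp add: delta_one.abs_eq)

lemma act_transitive:
  assumes "hypermap K" "y \<in> flags K" "z \<in> flags K"
  obtains g where "act K g y = z"
proof -
  have "z \<in> reach (invol K) UNIV y" using assms by (simp add: reach_UNIV)
  then obtain w where "z = fold (invol K) w y" by (rule reach_fold)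
  then show ?thesis using that act_abs_delta[OF assms(1,2)] by metis
qed

lemma act_inv:
  assumes "hypermap K" "y \<in> flags K"
  shows "act K (inv\<^bsub>Delta\<^esub> g) (act K g y) = y" "act K g (act K (inv\<^bsub>Delta\<^esub> g) y) = y"
proof -
  interpret group Delta by (rule group_Delta)
  show "act K (inv\<^bsub>Delta\<^esub> g) (act K g y) = y"
    using act_mult[OF assms, of g "inv\<^bsub>Delta\<^esub> g"] r_inv[of g] by (simp add: act_one[OF assms])
  show "act K g (act K (inv\<^bsub>Delta\<^esub> g) y) = y"
    using act_mult[OF assms, of "inv\<^bsub>Delta\<^esub> g" g] l_inv[of g] by (simp add: act_one[OF assms])
qed

lemma hypermap_subgroup_iff: "g \<in> hypermap_subgroup K y \<longleftrightarrow> act K g y = y"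
  by (simp add: hypermap_subgroup_def stabilizer_def)

lemma subgroup_hypermap_subgroup:
  assumes "hypermap K" "y \<in> flags K"
  shows "subgroup (hypermap_subgroup K y) Delta"
proof -
  interpret group Delta by (rule group_Delta)
  show ?thesis
  proof (rule subgroupI)
    show "hypermap_subgroup K y \<noteq> {}"
      using act_one[OF assms] by (auto simp: hypermap_subgroup_iff)
    show "inv\<^bsub>Delta\<^esub> g \<in> hypermap_subgroup K y" if "g \<in> hypermap_subgroup K y" for g
      using that act_inv[OF assms, of g] by (simp add: hypermap_subgroup_iff)
    show "g \<otimes>\<^bsub>Delta\<^esub> h \<in> hypermap_subgroup K y"
      if "g \<in> hypermap_subgroup K y" "h \<in> hypermap_subgroup K y" for g h
      using that act_mult[OF assms, of g h] by (simp add: hypermap_subgroup_iff)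
  qed auto
qed

text \<open>
  The stabiliser of \<open>y c\<close> is the conjugate by \<open>c\<close> of the stabiliser of \<open>y\<close>; so normality says
  that an element fixing \<open>y\<close> fixes the whole orbit of \<open>y\<close>. Stated for subgroups \<open>C\<close> of \<open>\<Delta>\<close> so
  as to cover regularity (\<open>C = \<Delta>\<close>) and bipartite-regularity (\<open>C = \<Delta>\<^sup>0\<close>) at once.
\<close>

lemma hypermap_subgroup_normal_iff:
  assumes K: "hypermap K" "y \<in> flags K" and C: "subgroup C Delta"
  shows "hypermap_subgroup K y \<lhd> Delta\<lparr>carrier := C\<rparr> \<longleftrightarrow>
    hypermap_subgroup K y \<subseteq> C \<and>
    (\<forall>c\<in>C. \<forall>g. act K g y = y \<longrightarrow> act K g (act K c y) = act K c y)"
proof -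
  interpret group Delta by (rule group_Delta)
  interpret C: group "Delta\<lparr>carrier := C\<rparr>"
    by (rule subgroup.subgroup_is_group[OF C group_Delta])
  let ?H = "hypermap_subgroup K y"
  have H: "subgroup ?H Delta" by (rule subgroup_hypermap_subgroup[OF K])
  have sub: "subgroup ?H (Delta\<lparr>carrier := C\<rparr>) \<longleftrightarrow> ?H \<subseteq> C"
    using subgroup_incl[OF H C] subgroup.subset[of ?H "Delta\<lparr>carrier := C\<rparr>"] by auto
  have conj: "c \<otimes>\<^bsub>Delta\<^esub> g \<otimes>\<^bsub>Delta\<^esub> inv\<^bsub>Delta\<^esub> c \<in> ?H \<longleftrightarrow>
      act K g (act K c y) = act K c y" for c g
  proof -
    have *: "act K (c \<otimes>\<^bsub>Delta\<^esub> g \<otimes>\<^bsub>Delta\<^esub> inv\<^bsub>Delta\<^esub> c) y =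
        act K (inv\<^bsub>Delta\<^esub> c) (act K g (act K c y))"
      using K by (simp only: act_mult act_closed)
    show ?thesis
      unfolding hypermap_subgroup_iff *
      using act_inv[OF K(1) act_closed[OF K(1) act_closed[OF K]]] act_inv[OF K] by metis
  qed
  have "?H \<lhd> Delta\<lparr>carrier := C\<rparr> \<longleftrightarrow> ?H \<subseteq> C \<and>
     (\<forall>c\<in>C. \<forall>g\<in>?H. c \<otimes>\<^bsub>Delta\<^esub> g \<otimes>\<^bsub>Delta\<^esub> inv\<^bsub>Delta\<^esub> c \<in> ?H)"
    unfolding C.normal_inv_iff sub using m_inv_consistent[OF C] by auto
  then show ?thesis unfolding conj by (auto simp: hypermap_subgroup_iff)
qed

lemma regular_iff:
  assumes K: "hypermap K"
  shows "regular K \<longleftrightarrow>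
    (\<forall>y\<in>flags K. \<forall>z\<in>flags K. \<forall>g. act K g y = y \<longrightarrow> act K g z = z)"
proof -
  interpret group Delta by (rule group_Delta)
  have D: "Delta\<lparr>carrier := UNIV\<rparr> = Delta" "subgroup UNIV Delta"
    using subgroup_self by (simp_all add: Delta_def)
  have "(\<forall>c g. act K g y = y \<longrightarrow> act K g (act K c y) = act K c y) \<longleftrightarrow>
      (\<forall>z\<in>flags K. \<forall>g. act K g y = y \<longrightarrow> act K g z = z)" if "y \<in> flags K" for y
    using act_closed[OF K that] act_transitive[OF K that] by metis
  then show ?thesis
    unfolding regular_def using K hypermap_subgroup_normal_iff[OF K _ D(2)] by (simp add: D(1))
qed


section \<open>Isomorphic hypermaps\<close>

definition hypermap_iso :: "('a \<Rightarrow> 'b) \<Rightarrow> 'a hypermap \<Rightarrow> 'b hypermap \<Rightarrow> bool" where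
  "hypermap_iso f L M \<longleftrightarrow> bij_betw f (flags L) (flags M) \<and>
     (\<forall>i. \<forall>y\<in>flags L. f (invol L i y) = invol M i (f y))"

lemma hypermap_iso_reach:
  assumes "hypermap_iso f L M" "hypermap L" "y \<in> flags L"
  shows "reach (invol M) I (f y) = f ` reach (invol L) I y"
proof
  show "reach (invol M) I (f y) \<subseteq> f ` reach (invol L) I y"
  proof
    fix z assume "z \<in> reach (invol M) I (f y)"
    then show "z \<in> f ` reach (invol L) I y"
    proof (induction rule: reach.induct)
      case base
      show ?case by (simp add: reach.base)
    next
      case (step z i)
      then obtain u where u: "u \<in> reach (invol L) I y" "z = f u" by blast
      then have "u \<in> flags L" using reach_subset_flags[OF assms(2,3)] by blast
      then have "invol M i z = f (invol L i u)"
        using assms(1) u(2) by (simp add: hypermap_iso_def)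
      then show ?case using reach.step[OF u(1) step(2)] by blast
    qed
  qed
  show "f ` reach (invol L) I y \<subseteq> reach (invol M) I (f y)"
  proof clarify
    fix u assume "u \<in> reach (invol L) I y"
    then show "f u \<in> reach (invol M) I (f y)"
    proof (induction rule: reach.induct)
      case base
      show ?case by (rule reach.base)
    next
      case (step u i)
      then have "u \<in> flags L" using reach_subset_flags[OF assms(2,3)] by blast
      then have "f (invol L i u) = invol M i (f u)"
        using assms(1) by (simp add: hypermap_iso_def)
      then show ?case using step reach.step by metis
    qed
  qed
qed

lemma hypermap_iso_hypermap:
  assumes iso: "hypermap_iso f L M" and L: "hypermap L"
    and ext: "\<And>i. invol M i \<in> extensional (flags M)"
  shows "hypermap M"
proof -
  have M: "flags M = f ` flags L" and inj: "inj_on f (flags L)"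
    using iso by (auto simp: hypermap_iso_def bij_betw_def)
  have eq: "invol M i (f y) = f (invol L i y)" if "y \<in> flags L" for i y
    using iso that by (simp add: hypermap_iso_def)
  show ?thesis
  proof (rule hypermapI)
    show "finite (flags M)" "flags M \<noteq> {}" using L by (auto simp: M hypermap_def)
    show "z \<in> reach (invol M) UNIV y" if "y \<in> flags M" "z \<in> flags M" for y z
      using that hypermap_iso_reach[OF iso L] reach_UNIV[OF L] by (auto simp: M)
    show "invol M i y \<noteq> y" if "y \<in> flags M" for i y
      using that inj L by (auto simp: M eq hypermap_involD inj_on_eq_iff)
  qed (use ext L in \<open>auto simp: M eq hypermap_involD\<close>)
qed

lemma hypermap_iso_faces:
  assumes "hypermap_iso f L M" "hypermap L" "hypermap M"
  shows "faces k M = image f ` faces k L"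
proof -
  have "flags M = f ` flags L"
    using assms(1) by (auto simp: hypermap_iso_def bij_betw_def)
  then show ?thesis
    using hypermap_iso_reach[OF assms(1,2)]
    by (simp add: faces_eq_reach assms image_image cong: image_cong)
qed

lemma hypermap_iso_act:
  assumes "hypermap_iso f L M" "hypermap L" "y \<in> flags L"
  shows "act M g (f y) = f (act L g y)"
proof -
  have "fold (invol M) w (f y) = f (fold (invol L) w y)" for w
    using assms(3)
  proof (induction w arbitrary: y)
    case (Cons i w)
    moreover have "invol M i (f y) = f (invol L i y)"
      using assms(1) Cons.prems by (simp add: hypermap_iso_def)
    ultimately show ?case by (simp add: hypermap_involD(1)[OF assms(2)])
  qed simp
  then show ?thesis by (simp add: act_def)
qed

lemma hypermap_iso_orbit:
  assumes "hypermap_iso f L M" "hypermap L" "y \<in> flags L"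
  shows "orbit G (act M) (f y) = f ` orbit G (act L) y"
  unfolding orbit_def using hypermap_iso_act[OF assms] by auto

lemma hypermap_iso_subgroup:
  assumes "hypermap_iso f L M" "hypermap L" "y \<in> flags L"
  shows "hypermap_subgroup M (f y) = hypermap_subgroup L y"
proof -
  have "inj_on f (flags L)"
    using assms(1) by (simp add: hypermap_iso_def bij_betw_def)
  then have "f (act L g y) = f y \<longleftrightarrow> act L g y = y" for g
    using act_closed[OF assms(2,3)] assms(3) by (simp add: inj_on_eq_iff)
  then show ?thesis
    using hypermap_iso_act[OF assms] by (auto simp: hypermap_subgroup_iff)
qed

lemma hypermap_iso_bipartite_regular:
  assumes "hypermap_iso f L M" "hypermap L" "hypermap M"
  shows "bipartite M \<longleftrightarrow> bipartite L" "bipartite_regular M \<longleftrightarrow> bipartite_regular L"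
proof -
  have "flags M = f ` flags L"
    using assms(1) by (auto simp: hypermap_iso_def bij_betw_def)
  then show "bipartite M \<longleftrightarrow> bipartite L" "bipartite_regular M \<longleftrightarrow> bipartite_regular L"
    using assms hypermap_iso_subgroup[OF assms(1,2)]
    by (auto simp: bipartite_def bipartite_regular_def)
qed

text \<open>
  Orbit-stabiliser correspondence: the coset that belongs to the flag \<open>y\<close> consists of all
  elements that carry the base flag \<open>p\<close> to \<open>y\<close>.
\<close>

definition transporter :: "'a hypermap \<Rightarrow> 'a \<Rightarrow> 'a \<Rightarrow> delta set" where
  "transporter L p y = {g. act L g p = y}"

lemma transporter_act:
  assumes L: "hypermap L" "p \<in> flags L" and y: "y \<in> flags L"
  shows "transporter L p (act L h y) = transporter L p y #>\<^bsub>Delta\<^esub> h"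
proof -
  interpret group Delta by (rule group_Delta)
  have "act L g p = act L h y \<longleftrightarrow> (\<exists>k. act L k p = y \<and> g = delta_mult k h)" for g
  proof
    assume g: "act L g p = act L h y"
    let ?k = "g \<otimes>\<^bsub>Delta\<^esub> inv\<^bsub>Delta\<^esub> h"
    have "act L ?k p = y"
      using act_mult[OF L] g act_inv[OF L(1) y] by metis
    moreover have "g = ?k \<otimes>\<^bsub>Delta\<^esub> h"
      using m_assoc[of g "inv\<^bsub>Delta\<^esub> h" h] l_inv[of h] r_one[of g] by simp
    ultimately show "\<exists>k. act L k p = y \<and> g = delta_mult k h" by auto
  next
    assume "\<exists>k. act L k p = y \<and> g = delta_mult k h"
    then show "act L g p = act L h y" using act_mult[OF L] by auto
  qed
  then show ?thesis by (auto simp: transporter_def r_coset_def)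
qed

lemma transporter_base: "transporter L p p = hypermap_subgroup L p"
  by (auto simp: transporter_def hypermap_subgroup_iff)

lemma hypermap_iso_coset:
  assumes L: "hypermap L" "p \<in> flags L"
  shows "hypermap_iso (transporter L p) L (coset_hypermap (hypermap_subgroup L p))"
proof -
  let ?H = "hypermap_subgroup L p"
  have "inj_on (transporter L p) (flags L)"
  proof (rule inj_onI)
    fix y z assume "y \<in> flags L" and eq: "transporter L p y = transporter L p z"
    then obtain g where "act L g p = y" using act_transitive[OF L] by blast
    then show "y = z" using eq by (auto simp: transporter_def)
  qed
  moreover have "transporter L p ` flags L = rcosets\<^bsub>Delta\<^esub> ?H"
  proof -
    have "flags L = range (\<lambda>g. act L g p)"
      using act_closed[OF L] act_transitive[OF L] by blast
    then have "transporter L p ` flags L = range (\<lambda>g. transporter L p (act L g p))"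
      by auto
    also have "\<dots> = range (\<lambda>g. ?H #>\<^bsub>Delta\<^esub> g)"
      by (simp add: transporter_act[OF L L(2)] transporter_base)
    finally show ?thesis by (auto simp: RCOSETS_def)
  qed
  moreover have "transporter L p (invol L i y) = transporter L p y #>\<^bsub>Delta\<^esub> R i"
    if "y \<in> flags L" for i y
    using transporter_act[OF L that, of "R i"] act_R[OF L(1) that] by simp
  ultimately show ?thesis
    by (auto simp: hypermap_iso_def coset_hypermap_def bij_betw_def)
qed


section \<open>The Walsh epimorphism on even words\<close>

text \<open>
  An even word regroups into the generators \<open>R\<^sub>1, R\<^sub>2, R\<^sub>1\<^sup>R\<^sup>0, R\<^sub>2\<^sup>R\<^sup>0\<close> of \<open>\<Delta>\<^sup>0\<close>, which is why the
  epimorphism is determined by its values on them. The induction runs over all words: a word of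
  odd parity is completed by a leading \<open>I0\<close>, as if an \<open>I0\<close> had just been read, and
  \<open>walsh_word True\<close> translates the letters after it.
\<close>

lemma even_word_Delta0:
  "(\<not> word_parity w \<longrightarrow> abs_delta w \<in> carrier Delta0 \<and>
      phi_W (abs_delta w) = abs_delta (walsh_word False w)) \<and>
   (word_parity w \<longrightarrow> abs_delta (I0 # w) \<in> carrier Delta0 \<and>
      phi_W (abs_delta (I0 # w)) = abs_delta (walsh_word True w))"
proof (induction w)
  case Nil
  interpret D: group Delta by (rule group_Delta)
  interpret D0: group Delta0
    using D.subgroup_imp_group[OF subgroup_Delta0] by (simp add: Delta0_def)
  have "phi_W \<in> hom Delta0 Delta"
    using is_walsh_epi_phi_W by (simp add: is_walsh_epi_def epi_def)
  then have "phi_W \<one>\<^bsub>Delta0\<^esub> = \<one>\<^bsub>Delta\<^esub>"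
    using hom_one D0.is_group group_Delta by blast
  then show ?case
    using D0.one_closed by (simp add: Delta0_def delta_one.abs_eq)
next
  case (Cons i w)
  have hom: "phi_W (delta_mult g h) = delta_mult (phi_W g) (phi_W h)"
      "delta_mult g h \<in> carrier Delta0"
    if "g \<in> carrier Delta0" "h \<in> carrier Delta0" for g h
  proof -
    have "phi_W \<in> hom Delta0 Delta"
      using is_walsh_epi_phi_W by (simp add: is_walsh_epi_def epi_def)
    then show "phi_W (delta_mult g h) = delta_mult (phi_W g) (phi_W h)"
      using that by (auto simp: hom_def Delta0_def)
    show "delta_mult g h \<in> carrier Delta0"
      using subgroup.m_closed[OF subgroup_Delta0 that] by simp
  qed
  have R: "R j \<in> carrier Delta0" "phi_W (R j) = R j" if "j \<noteq> I0" for j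
    using that R_Delta0 is_walsh_epi_phi_W by (cases j; simp add: is_walsh_epi_def)+
  have low: "abs_delta (j # w) = delta_mult (R j) (abs_delta w)" for j
    by (simp add: R.abs_eq delta_mult.abs_eq)
  have conj: "abs_delta (I0 # j # w) = delta_mult (conj_by (R j) (R I0)) (abs_delta (I0 # w))" for j
  proof -
    have "conj_by (R j) (R I0) = abs_delta [I0, j, I0]"
      unfolding conj_by_def inv_R by (simp add: R.abs_eq delta_mult.abs_eq)
    moreover have "word_eq ([I0, j] @ [I0, I0] @ w) ([I0, j] @ w)"
      by (rule cancel_word_eq) (rule cancel.intros)
    ultimately show ?thesis
      by (simp add: delta_mult.abs_eq delta.abs_eq_iff word_eq_sym)
  qed
  have C: "conj_by (R I1) (R I0) \<in> carrier Delta0" "phi_W (conj_by (R I1) (R I0)) = R I0"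
      "conj_by (R I2) (R I0) \<in> carrier Delta0" "phi_W (conj_by (R I2) (R I0)) = R I2"
    using is_walsh_epi_phi_W by (simp_all add: is_walsh_epi_def conj_by_Delta0)
  have letter: "delta_mult (R j) (abs_delta v) = abs_delta (j # v)" for j v
    by (simp add: R.abs_eq delta_mult.abs_eq)
  show ?case
  proof (cases i)
    case I0
    have "word_eq ([] @ [I0, I0] @ w) ([] @ w)"
      by (rule cancel_word_eq) (rule cancel.intros)
    then have "abs_delta (I0 # I0 # w) = abs_delta w"
      by (simp add: delta.abs_eq_iff)
    then show ?thesis using Cons I0 by simp
  next
    case I1
    then show ?thesis using Cons
      by (simp add: low conj hom R C) (simp add: letter)
  next
    case I2
    then show ?thesis using Cons
      by (simp add: low conj hom R C) (simp add: letter)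
  qed
qed

lemma parity_abs: "parity (abs_delta w) = word_parity w"
  by (rule parity.abs_eq)

lemma carrier_Delta0_iff: "g \<in> carrier Delta0 \<longleftrightarrow> \<not> parity g"
proof -
  obtain w where "g = abs_delta w" by (rule delta_cases)
  then show ?thesis using parity_Delta0 even_word_Delta0[of w] parity_abs by auto
qed

lemma phi_W_eq_walsh: "g \<in> carrier Delta0 \<Longrightarrow> phi_W g = walsh g"
proof -
  assume g: "g \<in> carrier Delta0"
  obtain w where w: "g = abs_delta w" by (rule delta_cases)
  then show ?thesis
    using even_word_Delta0[of w] parity_Delta0[OF g] parity_abs by (simp add: walsh.abs_eq)
qed


section \<open>The model on two copies of the flags\<close>

definition walsh_idx :: "bool \<Rightarrow> idx \<Rightarrow> idx" where
  "walsh_idx s i = (if s \<and> i = I1 then I0 else i)"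

definition double :: "'a hypermap \<Rightarrow> ('a \<times> bool) hypermap" where
  "double K =
     \<lparr>flags = flags K \<times> UNIV,
      invol = (\<lambda>i. \<lambda>(y, s) \<in> flags K \<times> UNIV.
        if i = I0 then (y, \<not> s) else (invol K (walsh_idx s i) y, s))\<rparr>"

lemma flags_double [simp]: "flags (double K) = flags K \<times> UNIV"
  by (simp add: double_def)

lemma invol_double:
  assumes "y \<in> flags K"
  shows "invol (double K) i (y, s) =
    (if i = I0 then (y, \<not> s) else (invol K (walsh_idx s i) y, s))"
  using assms by (simp add: double_def)

text \<open>
  A walk in the model projects to a walk in \<open>K\<close> whose letters depend on the sheet. If \<open>R\<^sub>0\<close> is
  among the generators both sheets have to be considered; otherwise the walk stays on its own.
\<close>

lemma reach_double_subset:
  assumes K: "hypermap K" and y: "y \<in> flags K" and p: "p \<in> reach (invol (double K)) I (y, s)"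
    and "\<And>t i. i \<in> I \<Longrightarrow> i \<noteq> I0 \<Longrightarrow> I0 \<in> I \<or> t = s \<Longrightarrow> walsh_idx t i \<in> J"
  shows "fst p \<in> reach (invol K) J y \<and> (I0 \<in> I \<or> snd p = s)"
  using p
proof (induction rule: reach.induct)
  case base
  show ?case by (simp add: reach.base)
next
  case (step p i)
  obtain z t where p: "p = (z, t)" by (cases p)
  have "z \<in> flags K" using step(3) reach_subset_flags[OF K y] by (auto simp: p)
  then show ?case
    using step assms(4)[of i t] by (auto simp: p invol_double intro: reach.step)
qed

text \<open>
  With both \<open>R\<^sub>0\<close> and \<open>R\<^sub>1\<close> available, a step by the \<open>R\<^sub>0\<close> of \<open>K\<close> is made by moving to the upper
  sheet and using \<open>R\<^sub>1\<close> there, and all flags are met on both sheets. This covers hyperfaces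
  (\<open>I = {I0, I1}\<close>) and transitivity (\<open>I = UNIV\<close>).
\<close>

lemma reach_double_both_sheets:
  assumes K: "hypermap K" and y: "y \<in> flags K" and I: "I0 \<in> I" "I1 \<in> I"
  shows "reach (invol (double K)) I (y, s) = reach (invol K) I y \<times> UNIV"
proof
  show "reach (invol (double K)) I (y, s) \<subseteq> reach (invol K) I y \<times> UNIV"
    using reach_double_subset[OF K y, of _ I s I] I
    by (fastforce simp: walsh_idx_def)
  have flip: "(z, u) \<in> reach (invol (double K)) I (y, s)"
    if "(z, t) \<in> reach (invol (double K)) I (y, s)" "z \<in> flags K" for z t u
  proof -
    have "(z, \<not> t) \<in> reach (invol (double K)) I (y, s)"
      using reach.step[OF that(1) I(1)] that(2) by (simp add: invol_double)
    then show ?thesis using that(1) by (cases "u = t") auto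
  qed
  have "\<forall>t. (z, t) \<in> reach (invol (double K)) I (y, s)" if "z \<in> reach (invol K) I y" for z
    using that
  proof (induction rule: reach.induct)
    case base
    show ?case using flip[OF reach.base y] by blast
  next
    case (step z i)
    have z: "z \<in> flags K" using step(1) reach_subset_flags[OF K y] by blast
    have hz: "invol K i z \<in> flags K" by (rule hypermap_involD[OF K z])
    have "\<exists>t. (invol K i z, t) \<in> reach (invol (double K)) I (y, s)"
    proof (cases i)
      case I0
      have "(z, True) \<in> reach (invol (double K)) I (y, s)" using step.IH by blast
      from reach.step[OF this I(2)] show ?thesis
        using z I0 by (auto simp: invol_double walsh_idx_def)
    next
      case I1
      have "(z, False) \<in> reach (invol (double K)) I (y, s)" using step.IH by blast
      from reach.step[OF this step(2)] show ?thesis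
        using z I1 by (auto simp: invol_double walsh_idx_def)
    next
      case I2
      have "(z, False) \<in> reach (invol (double K)) I (y, s)" using step.IH by blast
      from reach.step[OF this step(2)] show ?thesis
        using z I2 by (auto simp: invol_double walsh_idx_def)
    qed
    then show ?case using flip[OF _ hz] by blast
  qed
  then show "reach (invol K) I y \<times> UNIV \<subseteq> reach (invol (double K)) I (y, s)" by auto
qed

lemma hypermap_double:
  assumes "hypermap K"
  shows "hypermap (double K)"
proof (rule hypermapI)
  show "finite (flags (double K))" "flags (double K) \<noteq> {}"
    using assms by (auto simp: hypermap_def)
  show "invol (double K) i \<in> extensional (flags (double K))" for i
    by (simp add: double_def)
  show "q \<in> reach (invol (double K)) UNIV p"
    if "p \<in> flags (double K)" "q \<in> flags (double K)" for p q
    using that reach_double_both_sheets[OF assms] reach_UNIV[OF assms] by auto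
qed (use assms in \<open>auto simp: invol_double hypermap_involD split: if_splits\<close>)

text \<open>
  The group generated by \<open>R\<^sub>1, R\<^sub>2\<close> keeps to one sheet: on the lower one it acts as it does on
  \<open>K\<close>, on the upper one as the group generated by \<open>R\<^sub>0, R\<^sub>2\<close> does.
\<close>

lemma reach_double_one_sheet:
  assumes K: "hypermap K" and y: "y \<in> flags K"
  shows "reach (invol (double K)) (- {I0}) (y, s) =
    reach (invol K) (- {if s then I1 else I0}) y \<times> {s}"
    (is "_ = reach _ ?J y \<times> _")
proof
  show "reach (invol (double K)) (- {I0}) (y, s) \<subseteq> reach (invol K) ?J y \<times> {s}"
  proof
    fix p assume "p \<in> reach (invol (double K)) (- {I0}) (y, s)"
    then have "fst p \<in> reach (invol K) ?J y \<and> (I0 \<in> - {I0} \<or> snd p = s)"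
      by (rule reach_double_subset[OF K y]) (auto simp: walsh_idx_def split: if_splits)
    then show "p \<in> reach (invol K) ?J y \<times> {s}" by (cases p) auto
  qed
  have "(z, s) \<in> reach (invol (double K)) (- {I0}) (y, s)" if "z \<in> reach (invol K) ?J y" for z
    using that
  proof (induction rule: reach.induct)
    case base
    show ?case by (rule reach.base)
  next
    case (step z i)
    have z: "z \<in> flags K" using step(1) reach_subset_flags[OF K y] by blast
    obtain j where j: "j \<noteq> I0" "walsh_idx s j = i"
    proof (cases "s \<and> i = I0")
      case True
      then show ?thesis using that[of I1] by (simp add: walsh_idx_def)
    next
      case False
      then show ?thesis using that[of i] step(2) by (auto simp: walsh_idx_def split: if_splits)
    qed
    then show ?case using reach.step[OF step.IH, of j] z by (simp add: invol_double)
  qed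
  then show "reach (invol K) ?J y \<times> {s} \<subseteq> reach (invol (double K)) (- {I0}) (y, s)" by auto
qed

lemma faces_double_I0:
  assumes K: "hypermap K"
  shows "faces I0 (double K) =
    (\<lambda>F. F \<times> {False}) ` faces I0 K \<union> (\<lambda>F. F \<times> {True}) ` faces I1 K"
proof -
  have "faces I0 (double K) =
      (\<Union>s. (\<lambda>y. reach (invol (double K)) (- {I0}) (y, s)) ` flags K)"
    unfolding faces_eq_reach[OF hypermap_double[OF K]] by auto
  also have "\<dots> = (\<Union>s. (\<lambda>y. reach (invol K) (- {if s then I1 else I0}) y \<times> {s}) ` flags K)"
    by (simp add: reach_double_one_sheet[OF K] cong: image_cong)
  finally show ?thesis by (simp add: faces_eq_reach[OF K] UNIV_bool image_image Un_commute)
qed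

lemma faces_double_I2:
  assumes K: "hypermap K"
  shows "faces I2 (double K) = (\<lambda>F. F \<times> UNIV) ` faces I2 K"
proof -
  have "faces I2 (double K) =
      (\<lambda>(y, s). reach (invol (double K)) (- {I2}) (y, s)) ` (flags K \<times> UNIV)"
    unfolding faces_eq_reach[OF hypermap_double[OF K]] by simp
  also have "\<dots> = (\<lambda>(y, s). reach (invol K) (- {I2}) y \<times> UNIV) ` (flags K \<times> (UNIV :: bool set))"
    using reach_double_both_sheets[OF K, of _ "- {I2}"] by (intro image_cong) auto
  also have "\<dots> = (\<lambda>F. F \<times> UNIV) ` faces I2 K"
    unfolding faces_eq_reach[OF K] by force
  finally show ?thesis .
qed

lemma face_double_I1:
  assumes K: "hypermap K" and F: "F \<in> faces I1 (double K)"
  obtains y where "y \<in> flags K" "F = {y, invol K I2 y} \<times> UNIV"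
proof -
  obtain y s where y: "y \<in> flags K" and F: "F = reach (invol (double K)) (- {I1}) (y, s)"
    using F by (auto simp: faces_eq_reach[OF hypermap_double[OF K]])
  have y2: "invol K I2 y \<in> flags K" "invol K I2 (invol K I2 y) = y"
    using hypermap_involD[OF K y] by auto
  let ?h = "invol (double K)"
  have I: "- {I1} = {I0, I2}" using UNIV_idx by auto
  have "p \<in> {y, invol K I2 y} \<times> UNIV" if "p \<in> F" for p
    by (rule reach_closed[OF that[unfolded F I]])
      (use y y2 in \<open>auto simp: invol_double walsh_idx_def split: if_splits\<close>)
  moreover have "(y, t) \<in> F" for t
    using reach.base[of "(y, s)" ?h] reach.step[OF reach.base, of I0 _ ?h "(y, s)"] y
    by (cases "t = s") (auto simp: F invol_double)
  then have "(y, t) \<in> F \<and> (invol K I2 y, t) \<in> F" for t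
    using reach.step[of "(y, t)" ?h _ _ I2] y by (auto simp: F invol_double walsh_idx_def)
  ultimately have "F = {y, invol K I2 y} \<times> UNIV" by auto
  then show ?thesis using that y by blast
qed


section \<open>The model and the Walsh subgroup\<close>

text \<open>
  The Boolean argument of \<open>walsh_word\<close> records the sheet, as it is toggled exactly by the letters \<open>R\<^sub>0\<close>;
  reading a word in the model is therefore reading its Walsh translation in \<open>K\<close>.
\<close>

lemma act_double:
  assumes K: "hypermap K" and y: "y \<in> flags K"
  shows "act (double K) (abs_delta w) (y, s) =
    (act K (abs_delta (walsh_word s w)) y, s \<noteq> word_parity w)"
proof -
  have "fold (invol (double K)) w (y, s) = (fold (invol K) (walsh_word s w) y, s \<noteq> word_parity w)"
    using y
  proof (induction w arbitrary: y s)
    case (Cons i w)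
    then show ?case
      by (cases i) (auto simp: invol_double walsh_idx_def hypermap_involD[OF K])
  qed simp
  then show ?thesis using act_abs_delta[OF K y] act_abs_delta[OF hypermap_double[OF K]] y by simp
qed

lemma act_double_lower:
  assumes "hypermap K" "y \<in> flags K"
  shows "act (double K) g (y, False) = (act K (walsh g) y, parity g)"
proof -
  obtain w where "g = abs_delta w" by (rule delta_cases)
  then show ?thesis using act_double[OF assms] by (simp add: walsh.abs_eq parity_abs)
qed

lemma snd_act_double:
  assumes "hypermap K" "y \<in> flags K"
  shows "snd (act (double K) g (y, s)) \<longleftrightarrow> s \<noteq> parity g"
proof -
  obtain w where "g = abs_delta w" by (rule delta_cases)
  then show ?thesis using act_double[OF assms] by (simp add: parity_abs)
qed

lemma Wal_subgroup_eq:
  assumes "hypermap K" "x \<in> flags K"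
  shows "Wal_subgroup K x = hypermap_subgroup (double K) (x, False)"
  using act_double_lower[OF assms] phi_W_eq_walsh
  by (auto simp: Wal_subgroup_def hypermap_subgroup_iff carrier_Delta0_iff)

lemma Wal_iso_double:
  assumes "hypermap K" "x \<in> flags K"
  shows "hypermap_iso (transporter (double K) (x, False)) (double K) (Wal K x)"
  using hypermap_iso_coset[OF hypermap_double[OF assms(1)], of "(x, False)"] assms
  by (simp add: Wal_def Wal_subgroup_eq)

lemma hypermap_Wal:
  assumes "hypermap K" "x \<in> flags K"
  shows "hypermap (Wal K x)"
  by (rule hypermap_iso_hypermap[OF Wal_iso_double[OF assms] hypermap_double[OF assms(1)]])
    (simp add: Wal_def coset_hypermap_def)

lemma orbit_Delta0_double:
  assumes K: "hypermap K" "y \<in> flags K"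
  shows "orbit Delta0 (act (double K)) (y, s) = flags K \<times> {s}"
proof
  have p: "(y, s) \<in> flags (double K)" using K by simp
  show "orbit Delta0 (act (double K)) (y, s) \<subseteq> flags K \<times> {s}"
  proof
    fix q assume "q \<in> orbit Delta0 (act (double K)) (y, s)"
    then obtain g where g: "\<not> parity g" "q = act (double K) g (y, s)"
      by (auto simp: orbit_def carrier_Delta0_iff)
    then have "q \<in> flags (double K)" "snd q = s"
      using act_closed[OF hypermap_double[OF K(1)] p] snd_act_double[OF K] by auto
    then show "q \<in> flags K \<times> {s}" by (cases q) auto
  qed
  show "flags K \<times> {s} \<subseteq> orbit Delta0 (act (double K)) (y, s)"
  proof
    fix q assume q: "q \<in> flags K \<times> {s}"
    then obtain g where g: "act (double K) g (y, s) = q"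
      using act_transitive[OF hypermap_double[OF K(1)] p, of q] by auto
    then have "g \<in> carrier Delta0"
      using q snd_act_double[OF K, of g s] by (auto simp: carrier_Delta0_iff)
    then show "q \<in> orbit Delta0 (act (double K)) (y, s)" using g by (auto simp: orbit_def)
  qed
qed

lemma bipartite_double:
  assumes K: "hypermap K"
  shows "bipartite (double K)"
  using hypermap_double[OF K] snd_act_double[OF K]
  by (auto simp: bipartite_def hypermap_subgroup_iff carrier_Delta0_iff) (metis snd_conv)


section \<open>Regularity\<close>

text \<open>
  An element of \<open>\<Delta>\<^sup>0\<close> acts on each sheet as some element of \<open>\<Delta>\<close> acts on \<open>K\<close>, which gives one
  direction. For the other, surjectivity of the Walsh epimorphism realises every
  element of \<open>\<Delta>\<close> on the lower sheet.
\<close>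

lemma bipartite_regular_double_iff:
  assumes K: "hypermap K"
  shows "bipartite_regular (double K) \<longleftrightarrow> regular K"
proof -
  let ?D = "double K"
  have D: "hypermap ?D" by (rule hypermap_double[OF K])
  have norm: "hypermap_subgroup ?D (y, s) \<lhd> Delta0 \<longleftrightarrow>
      (\<forall>z\<in>flags K. \<forall>g. act ?D g (y, s) = (y, s) \<longrightarrow> act ?D g (z, s) = (z, s))"
    if y: "y \<in> flags K" for y s
  proof -
    have "Delta\<lparr>carrier := carrier Delta0\<rparr> = Delta0" by (simp add: Delta0_def)
    moreover have "hypermap_subgroup ?D (y, s) \<subseteq> carrier Delta0"
      using bipartite_double[OF K] y by (auto simp: bipartite_def)
    moreover have "orbit Delta0 (act ?D) (y, s) = (\<lambda>c. act ?D c (y, s)) ` carrier Delta0"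
      by (auto simp: orbit_def)
    ultimately have "hypermap_subgroup ?D (y, s) \<lhd> Delta0 \<longleftrightarrow>
        (\<forall>q\<in>orbit Delta0 (act ?D) (y, s). \<forall>g. act ?D g (y, s) = (y, s) \<longrightarrow> act ?D g q = q)"
      using hypermap_subgroup_normal_iff[OF D _ subgroup_Delta0, of "(y, s)"] y by simp
    then show ?thesis unfolding orbit_Delta0_double[OF K y] by auto
  qed
  show ?thesis
  proof
    assume reg: "bipartite_regular ?D"
    have "act K h z = z" if y: "y \<in> flags K" and z: "z \<in> flags K" and h: "act K h y = y" for y z h
    proof -
      have "h \<in> walsh ` carrier Delta0"
        using is_walsh_epi_walsh by (simp add: is_walsh_epi_def epi_def)
      then obtain g where g: "\<not> parity g" "h = walsh g" by (auto simp: carrier_Delta0_iff)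
      then have "act ?D g (y, False) = (y, False)" using act_double_lower[OF K y] h by simp
      moreover have "hypermap_subgroup ?D (y, False) \<lhd> Delta0"
        using reg y by (auto simp: bipartite_regular_def)
      ultimately have "act ?D g (z, False) = (z, False)" using norm[OF y] z by blast
      then show ?thesis using act_double_lower[OF K z] g by simp
    qed
    then show "regular K" using regular_iff[OF K] by blast
  next
    assume "regular K"
    then have fix_all: "\<forall>y\<in>flags K. \<forall>z\<in>flags K. \<forall>g. act K g y = y \<longrightarrow> act K g z = z"
      by (rule regular_iff[OF K, THEN iffD1])
    have same: "act ?D g (z, s) = (z, s)"
      if y: "y \<in> flags K" and z: "z \<in> flags K" and g: "act ?D g (y, s) = (y, s)" for y z g s
    proof -
      obtain w where w: "g = abs_delta w" by (rule delta_cases)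
      let ?h = "abs_delta (walsh_word s w)"
      have "(act K ?h y, s \<noteq> word_parity w) = (y, s)"
        using g unfolding w act_double[OF K y] .
      then have "act K ?h y = y" and even: "\<not> word_parity w" by auto
      then have "act K ?h z = z" using fix_all y z by blast
      then show ?thesis using even act_double[OF K z, of w s] by (simp add: w)
    qed
    have "hypermap_subgroup ?D (y, s) \<lhd> Delta0" if "y \<in> flags K" for y s
      unfolding norm[OF that] using same[OF that] by blast
    then show "bipartite_regular ?D"
      using D by (simp add: bipartite_regular_def)
  qed
qed


section \<open>Valencies\<close>

lemma even_card_involution:
  assumes "finite F" "\<And>y. y \<in> F \<Longrightarrow> h y \<in> F \<and> h (h y) = y \<and> h y \<noteq> y"
  shows "even (card F)"
proof -
  let ?C = "(\<lambda>y. {y, h y}) ` F"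
  have "\<Union> ?C = F" using assms(2) by auto
  moreover have "2 * card ?C = card (\<Union> ?C)"
  proof (rule card_partition)
    show "card c = 2" if c: "c \<in> ?C" for c
    proof -
      obtain y where "y \<in> F" "c = {y, h y}" using c by blast
      then show ?thesis using assms(2)[of y] by auto
    qed
    show "c1 \<inter> c2 = {}" if c: "c1 \<in> ?C" "c2 \<in> ?C" "c1 \<noteq> c2" for c1 c2
    proof -
      obtain y z where y: "y \<in> F" "c1 = {y, h y}" and z: "z \<in> F" "c2 = {z, h z}"
        using c by blast
      have "h (h y) = y" "h (h z) = z" using assms(2) y(1) z(1) by simp_all
      then have "c1 = c2" if "u \<in> c1" "u \<in> c2" for u 
        using that unfolding y z by (metis insert_iff empty_iff insert_commute)
      then show ?thesis using c(3) by blast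
    qed
  qed (use assms calculation in auto)
  ultimately show ?thesis by (metis dvd_triv_left)
qed

text \<open>
  The valency is a rounded half of a cardinality, so that doubling a hyperface doubles its
  valency only because faces have even size: each is a union of two-element orbits of any
  generator that preserves it.
\<close>

lemma even_card_face:
  assumes K: "hypermap K" and F: "F \<in> faces k K"
  shows "even (card F)"
proof -
  obtain y where y: "y \<in> flags K" "F = reach (invol K) (- {k}) y"
    using F by (auto simp: faces_eq_reach[OF K])
  obtain i where "i \<noteq> k" by (metis idx.distinct(1))
  then have "invol K i z \<in> F" if "z \<in> F" for z
    using that y(2) reach.step[of z] by auto
  moreover have "F \<subseteq> flags K" by (rule face_subset[OF K F])
  moreover have "finite F" using calculation(2) K finite_subset by (auto simp: hypermap_def)
  ultimately show ?thesis
    using hypermap_involD[OF K] by (intro even_card_involution[of F "invol K i"]) auto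
qed

lemma valency_image:
  assumes "inj_on f S" "F \<subseteq> S"
  shows "valency (f ` F) = valency F"
  using assms by (simp add: valency_def card_image inj_on_subset)

lemma valency_one_sheet: "valency (F \<times> {s}) = valency F"
  by (simp add: valency_def card_cartesian_product)

lemma valency_both_sheets:
  assumes "even (card F)"
  shows "valency (F \<times> (UNIV :: bool set)) = 2 * valency F"
  using assms by (simp add: valency_def card_cartesian_product)


section \<open>The Walsh hypermap\<close>

context
  fixes K :: "'a hypermap" and x :: 'a
  assumes K: "hypermap K" and x: "x \<in> flags K"
begin

definition sheet :: "bool \<Rightarrow> delta set set" where
  "sheet s = transporter (double K) (x, False) ` (flags K \<times> {s})"

lemma inj_transporter: "inj_on (transporter (double K) (x, False)) (flags K \<times> UNIV)"
  using Wal_iso_double[OF K x] by (simp add: hypermap_iso_def bij_betw_def)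

lemma faces_Wal: "faces k (Wal K x) = image (transporter (double K) (x, False)) ` faces k (double K)"
  by (rule hypermap_iso_faces[OF Wal_iso_double[OF K x] hypermap_double[OF K] hypermap_Wal[OF K x]])

lemma orbit_Wal:
  assumes "y \<in> flags K"
  shows "orbit Delta0 (act (Wal K x)) (transporter (double K) (x, False) (y, s)) = sheet s"
  using hypermap_iso_orbit[OF Wal_iso_double[OF K x] hypermap_double[OF K], of "(y, s)" Delta0]
    orbit_Delta0_double[OF K assms] assms by (simp add: sheet_def)

lemma orbits_Wal: "orbits Delta0 (flags (Wal K x)) (act (Wal K x)) = {sheet False, sheet True}"
proof -
  let ?f = "transporter (double K) (x, False)"
  have "flags (Wal K x) = ?f ` (flags K \<times> UNIV)"
    using Wal_iso_double[OF K x] by (simp add: hypermap_iso_def bij_betw_def)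
  then have "orbits Delta0 (flags (Wal K x)) (act (Wal K x)) =
      (\<lambda>(y, s). orbit Delta0 (act (Wal K x)) (?f (y, s))) ` (flags K \<times> UNIV)"
    by (auto simp: orbits_def)
  also have "\<dots> = (\<lambda>(y, s). sheet s) ` (flags K \<times> UNIV)"
    using orbit_Wal by (intro image_cong) auto
  also have "\<dots> = range sheet" using x by force
  finally show ?thesis by (simp add: UNIV_bool)
qed

lemma orbit_base_Wal: "orbit Delta0 (act (Wal K x)) (Wal_subgroup K x) = sheet False"
  using orbit_Wal[OF x, of False] by (simp add: transporter_base Wal_subgroup_eq[OF K x])

lemma image_subset_sheet_iff:
  assumes "F \<subseteq> flags K" "F \<noteq> {}"
  shows "transporter (double K) (x, False) ` (F \<times> {s}) \<subseteq> sheet t \<longleftrightarrow> s = t"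
proof -
  have "transporter (double K) (x, False) p \<in> sheet t \<longleftrightarrow> p \<in> flags K \<times> {t}"
    if "p \<in> F \<times> {s}" for p
    unfolding sheet_def
    using that assms(1) by (intro inj_on_image_mem_iff[OF inj_transporter]) auto
  then have "transporter (double K) (x, False) ` (F \<times> {s}) \<subseteq> sheet t \<longleftrightarrow>
      F \<times> {s} \<subseteq> flags K \<times> {t}"
    unfolding image_subset_iff subset_eq by blast
  then show ?thesis using assms by auto
qed

lemma sheet_neq: "sheet False \<noteq> sheet True"
proof -
  have "\<not> sheet False \<subseteq> sheet True"
    using image_subset_sheet_iff[of "flags K" False True] x by (auto simp: sheet_def[of False])
  then show ?thesis by simp
qed

lemma valency_hypervertex_Wal:
  "(\<forall>F\<in>faces I0 (Wal K x). F \<subseteq> sheet s \<longrightarrow> valency F = l) \<longleftrightarrow>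
   (\<forall>F\<in>faces (if s then I1 else I0) K. valency F = l)"
proof -
  have val: "valency (transporter (double K) (x, False) ` (F \<times> {t})) = valency F"
    if "F \<subseteq> flags K" for F t
    using that by (subst valency_image[OF inj_transporter]) (auto simp: valency_one_sheet)
  show ?thesis
    unfolding faces_Wal faces_double_I0[OF K]
    using face_subset[OF K]
    by (cases s) (simp_all add: ball_Un image_subset_sheet_iff val)
qed

lemma valency_hyperedge_Wal:
  assumes "F \<in> faces I1 (Wal K x)"
  shows "valency F = 2"
proof -
  obtain G where G: "G \<in> faces I1 (double K)" "F = transporter (double K) (x, False) ` G"
    using assms by (auto simp: faces_Wal)
  obtain y where y: "y \<in> flags K" "G = {y, invol K I2 y} \<times> UNIV"
    using face_double_I1[OF K G(1)] by blast
  have "valency F = valency G"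
    unfolding G(2) y(2) using y(1) hypermap_involD(1)[OF K]
    by (intro valency_image[OF inj_transporter]) auto
  also have "\<dots> = 2"
    using hypermap_involD(3)[OF K y(1), of I2] unfolding y(2)
    by (simp add: valency_def card_cartesian_product)
  finally show ?thesis .
qed

lemma valency_hyperface_Wal:
  "(\<forall>F\<in>faces I2 (Wal K x). valency F = 2 * n) \<longleftrightarrow> (\<forall>F\<in>faces I2 K. valency F = n)"
proof -
  have "valency (transporter (double K) (x, False) ` (F \<times> UNIV)) = 2 * valency F"
    if "F \<in> faces I2 K" for F
    using face_subset[OF K that] even_card_face[OF K that]
    by (subst valency_image[OF inj_transporter]) (auto simp: valency_both_sheets)
  then show ?thesis by (simp add: faces_Wal faces_double_I2[OF K])
qed

lemma Wal_base_valency_iff: "Wal_base_valency K x l \<longleftrightarrow> (\<forall>F\<in>faces I0 K. valency F = l)"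
  unfolding Wal_base_valency_def orbit_base_Wal valency_hypervertex_Wal by simp

text \<open>
  The bipartite-type does not tell the two orbits apart, hence the disjunction: the smaller
  valency may belong to either sheet.
\<close>

lemma bipartite_uniform_Wal_iff:
  "bipartite_uniform (Wal K x) a b 2 (2 * n) \<longleftrightarrow>
     a \<le> b \<and> (uniform K a b n \<or> uniform K b a n)"
proof -
  let ?P = "\<lambda>A l. \<forall>F\<in>faces I0 (Wal K x). F \<subseteq> A \<longrightarrow> valency F = l"
  have two_set: "(\<exists>A B. {a, b} = {A, B} \<and> A \<noteq> B \<and> P A \<and> Q B) \<longleftrightarrow> P a \<and> Q b \<or> P b \<and> Q a"
    if "a \<noteq> b" for a b :: "delta set set" and P Q
    using that by (auto simp: doubleton_eq_iff)
  have orb: "(\<exists>A B. orbits Delta0 (flags (Wal K x)) (act (Wal K x)) = {A, B} \<and> A \<noteq> B \<and>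
        ?P A a \<and> ?P B b) \<longleftrightarrow>
      ?P (sheet False) a \<and> ?P (sheet True) b \<or> ?P (sheet True) a \<and> ?P (sheet False) b"
    unfolding orbits_Wal by (rule two_set[OF sheet_neq])
  have "bipartite (Wal K x)"
    using hypermap_iso_bipartite_regular(1)[OF Wal_iso_double[OF K x] hypermap_double[OF K]
        hypermap_Wal[OF K x]] bipartite_double[OF K] by simp
  then show ?thesis
    unfolding bipartite_uniform_def orb valency_hypervertex_Wal valency_hyperface_Wal
    using K valency_hyperedge_Wal by (auto simp: uniform_def)
qed

lemma uniform_iff_bipartite_uniform_Wal:
  "uniform K l m n \<longleftrightarrow>
     bipartite_uniform (Wal K x) (min l m) (max l m) 2 (2 * n) \<and> Wal_base_valency K x l"
proof -
  (* The base valency excludes the swapped type (m, l, n) unless l = m. *)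
  have eq: "l = m" if "uniform K m l n" "Wal_base_valency K x l"
    using that faces_nonempty[OF K, of I0] by (auto simp: uniform_def Wal_base_valency_iff)
  have base: "Wal_base_valency K x l" if "uniform K l m n"
    using that by (simp add: uniform_def Wal_base_valency_iff)
  have "bipartite_uniform (Wal K x) (min l m) (max l m) 2 (2 * n) \<longleftrightarrow>
      uniform K l m n \<or> uniform K m l n"
    unfolding bipartite_uniform_Wal_iff
    by (cases "l \<le> m") (auto simp: min_absorb1 max_absorb2 min_absorb2 max_absorb1)
  then show ?thesis using eq base by metis
qed

lemma regular_iff_bipartite_regular_Wal: "regular K \<longleftrightarrow> bipartite_regular (Wal K x)"
  using hypermap_iso_bipartite_regular(2)[OF Wal_iso_double[OF K x] hypermap_double[OF K]
      hypermap_Wal[OF K x]] bipartite_regular_double_iff[OF K] by simp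

end


theorem theorem10:
  fixes K :: "'a hypermap" and x :: 'a
  assumes "hypermap K" and "x \<in> flags K"
  shows
    "(\<forall>l m n.
        (l \<le> m \<longrightarrow>
          (uniform K l m n \<or> uniform K m l n \<longleftrightarrow>
           bipartite_uniform (Wal K x) l m 2 (2 * n))) \<and>
        (l \<ge> m \<longrightarrow>
          (uniform K l m n \<or> uniform K m l n \<longleftrightarrow>
           bipartite_uniform (Wal K x) m l 2 (2 * n)))) \<and>
     (\<forall>l m n.
        (l \<le> m \<longrightarrow>
          (uniform K l m n \<longleftrightarrow>
           bipartite_uniform (Wal K x) l m 2 (2 * n) \<and> Wal_base_valency K x l)) \<and>
        (l \<ge> m \<longrightarrow>
          (uniform K l m n \<longleftrightarrow>
           bipartite_uniform (Wal K x) m l 2 (2 * n) \<and> Wal_base_valency K x l))) \<and>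
     (regular K \<longleftrightarrow> bipartite_regular (Wal K x))"
proof (intro conjI allI impI)
  fix l m n :: nat
  show "uniform K l m n \<or> uniform K m l n \<longleftrightarrow>
      bipartite_uniform (Wal K x) l m 2 (2 * n)" if "l \<le> m"
    using that bipartite_uniform_Wal_iff[OF assms] by auto
  show "uniform K l m n \<or> uniform K m l n \<longleftrightarrow>
      bipartite_uniform (Wal K x) m l 2 (2 * n)" if "l \<ge> m"
    using that bipartite_uniform_Wal_iff[OF assms] by auto
  show "uniform K l m n \<longleftrightarrow>
      bipartite_uniform (Wal K x) l m 2 (2 * n) \<and> Wal_base_valency K x l" if "l \<le> m"
    using that uniform_iff_bipartite_uniform_Wal[OF assms, of l m n]
    by (simp add: min_absorb1 max_absorb2)
  show "uniform K l m n \<longleftrightarrow>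
      bipartite_uniform (Wal K x) m l 2 (2 * n) \<and> Wal_base_valency K x l" if "l \<ge> m"
    using that uniform_iff_bipartite_uniform_Wal[OF assms, of l m n]
    by (simp add: min_absorb2 max_absorb1)
  show "regular K \<longleftrightarrow> bipartite_regular (Wal K x)"
    by (rule regular_iff_bipartite_regular_Wal[OF assms])
qed

end
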